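(* Let $T$ be an $n\times n$ complex matrix with Cartesian decomposition $T=A+iB$, and let $\{g_i\}_{i=1}^n$ and $\{h_i\}_{i=1}^n$ be any proper pair of orthogonal bases of $\mathbb{C}^n$ such that $\{g_i\}$ consists of eigenvectors of $A$ and $\{h_i\}$ consists of eigenvectors of $B$. Then $T$ is unitarily equivalent to a complex symmetric matrix if $$\frac{\langle g_i,h_j\rangle}{\langle g_i,h_1\rangle\langle g_1,h_j\rangle}\in\mathbb{R}\qquad\text{for all } 2\le i,j\le n. \tag{$*$}$$ Moreover, if $A$ and $B$ both have $n$ distinct eigenvalues, then condition $( * )$ is also necessary for $T$ to be unitarily equivalent to a complex symmetric matrix.
   Context: A complex symmetric matrix is an $n\times n$ matrix $S$ with complex entries such that $S=S^t$ (transpose, no conjugation). A matrix $T$ is unitarily equivalent to $S$ if $S=U^*TU$ for some unitary $U$. $\langle\cdot,\cdot\rangle$ is the standard inner product on $\mathbb{C}^n$, linear in the first argument and conjugate-linear in the second. The Cartesian decomposition of $T$ is the unique expression $T=A+iB$ with $A,B$ self-adjoint, namely $A=\frac12(T+T^* )$ and $B=\frac1{2i}(T-T^* )$. A pair of orthogonal (not necessarily normalized) bases $\{g_i\}$ and $\{h_i\}$ of $\mathbb{C}^n$ is called proper if $\langle g_1,h_1\rangle\in\mathbb{R}$ and, whenever $\langle g_i,h_j\rangle=0$, one has $i\ne1$ and $j\ne1$; equivalently, the matrix $(\langle g_i,h_j\rangle)_{i,j=1}^n$ has real top-left entry and no zeros in its first row or first column. *)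

theory Defs
  imports
    "Jordan_Normal_Form.Schur_Decomposition"
    "Jordan_Normal_Form.Spectral_Radius"
begin

text \<open>
  The standard inner product of \<open>v\<close> and \<open>w\<close>, linear in the first argument and conjugate-linear
  in the second, is \<open>v \<bullet>c w\<close>; the conjugate transpose of \<open>A\<close> is \<open>mat_adjoint A\<close>.
\<close>

lemma mat_adjoint_dim:
  fixes A :: "complex mat"
  shows "dim_row (mat_adjoint A) = dim_col A" "dim_col (mat_adjoint A) = dim_row A"
  by (auto simp: mat_adjoint_def)

lemma mat_adjoint_index:
  fixes A :: "complex mat"
  assumes "i < dim_col A" "j < dim_row A"
  shows "mat_adjoint A $$ (i, j) = cnj (A $$ (j, i))"
  using assms by (auto simp: mat_adjoint_def mat_of_rows_def)

definition unitary_mat :: "nat \<Rightarrow> complex mat \<Rightarrow> bool" where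
  "unitary_mat n U \<longleftrightarrow>
     U \<in> carrier_mat n n \<and> mat_adjoint U * U = 1\<^sub>m n \<and> U * mat_adjoint U = 1\<^sub>m n"

definition unitarily_equivalent :: "nat \<Rightarrow> complex mat \<Rightarrow> complex mat \<Rightarrow> bool" where
  "unitarily_equivalent n T S \<longleftrightarrow>
     T \<in> carrier_mat n n \<and> S \<in> carrier_mat n n \<and>
     (\<exists>U. unitary_mat n U \<and> S = mat_adjoint U * T * U)"

definition complex_symmetric :: "nat \<Rightarrow> complex mat \<Rightarrow> bool" where
  "complex_symmetric n S \<longleftrightarrow> S \<in> carrier_mat n n \<and> transpose_mat S = S"

definition self_adjoint :: "nat \<Rightarrow> complex mat \<Rightarrow> bool" where
  "self_adjoint n A \<longleftrightarrow> A \<in> carrier_mat n n \<and> mat_adjoint A = A"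

definition cartesian_decomposition ::
    "nat \<Rightarrow> complex mat \<Rightarrow> complex mat \<Rightarrow> complex mat \<Rightarrow> bool" where
  "cartesian_decomposition n T A B \<longleftrightarrow>
     self_adjoint n A \<and> self_adjoint n B \<and> T = A + \<i> \<cdot>\<^sub>m B"

text \<open>The decomposition exists and is unique, with the usual explicit formulas.\<close>

lemma cartesian_decomposition_iff:
  assumes T: "T \<in> carrier_mat n n"
  shows "cartesian_decomposition n T A B \<longleftrightarrow>
     A = (1 / 2) \<cdot>\<^sub>m (T + mat_adjoint T) \<and> B = (1 / (2 * \<i>)) \<cdot>\<^sub>m (T - mat_adjoint T)"
proof
  assume d: "cartesian_decomposition n T A B"
  then have A: "A \<in> carrier_mat n n" "mat_adjoint A = A" and B: "B \<in> carrier_mat n n" "mat_adjoint B = B"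
    and TAB: "T = A + \<i> \<cdot>\<^sub>m B"
    by (auto simp: cartesian_decomposition_def self_adjoint_def)
  have a: "cnj (A $$ (j, i)) = A $$ (i, j)" if "i < n" "j < n" for i j
    using mat_adjoint_index[of i A j] A that by auto
  have b: "cnj (B $$ (j, i)) = B $$ (i, j)" if "i < n" "j < n" for i j
    using mat_adjoint_index[of i B j] B that by auto
  show "A = (1 / 2) \<cdot>\<^sub>m (T + mat_adjoint T) \<and> B = (1 / (2 * \<i>)) \<cdot>\<^sub>m (T - mat_adjoint T)"
    using A(1) B(1) T
    by (auto intro!: eq_matI simp: mat_adjoint_dim mat_adjoint_index TAB a b field_simps)
next
  assume "A = (1 / 2) \<cdot>\<^sub>m (T + mat_adjoint T) \<and> B = (1 / (2 * \<i>)) \<cdot>\<^sub>m (T - mat_adjoint T)"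
  then show "cartesian_decomposition n T A B"
    unfolding cartesian_decomposition_def self_adjoint_def using T
    by (auto intro!: eq_matI simp: mat_adjoint_dim mat_adjoint_index field_simps)
qed

definition orthogonal_basis :: "nat \<Rightarrow> (nat \<Rightarrow> complex vec) \<Rightarrow> bool" where
  "orthogonal_basis n g \<longleftrightarrow>
     inj_on g {1..n} \<and>
     vectorspace.basis class_ring (module_vec TYPE(complex) n) (g ` {1..n}) \<and>
     (\<forall>i\<in>{1..n}. \<forall>j\<in>{1..n}. i \<noteq> j \<longrightarrow> g i \<bullet>c g j = 0)"

definition proper_pair ::
    "nat \<Rightarrow> (nat \<Rightarrow> complex vec) \<Rightarrow> (nat \<Rightarrow> complex vec) \<Rightarrow> bool" where
  "proper_pair n g h \<longleftrightarrow>
     orthogonal_basis n g \<and> orthogonal_basis n h \<and>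
     g 1 \<bullet>c h 1 \<in> \<real> \<and>
     (\<forall>i\<in>{1..n}. \<forall>j\<in>{1..n}. g i \<bullet>c h j = 0 \<longrightarrow> i \<noteq> 1 \<and> j \<noteq> 1)"

end

theory Submission
  imports Defs
begin

text \<open>
  Let the columns of unitary matrices \<open>G\<close> and \<open>H\<close> be the rescaled vectors \<open>g\<^sub>i\<close> and \<open>h\<^sub>j\<close>, so that
  \<open>A = G D G\<^sup>*\<close> and \<open>B = H E H\<^sup>*\<close> with \<open>D\<close> and \<open>E\<close> diagonal. Everything is governed by the unitary
  matrix \<open>W = H\<^sup>* G\<close> of inner products \<open>\<langle>g\<^sub>i, h\<^sub>j\<rangle>\<close>. In the basis \<open>g\<close> the matrix \<open>T = A + i B\<close> becomes
  \<open>D + i W\<^sup>* E W\<close>, and this is symmetric as soon as \<open>W\<close> is real, because then \<open>W\<^sup>* = W\<^sup>t\<close>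
  (\<open>symmetric_in_real_position\<close>). There is freedom in \<open>W\<close>: the phases of the basis vectors may be
  changed. Rotating \<open>g\<^sub>i\<close> makes \<open>\<langle>g\<^sub>i, h\<^sub>1\<rangle>\<close> real, rotating \<open>h\<^sub>j\<close> makes \<open>\<langle>g\<^sub>1, h\<^sub>j\<rangle>\<close> real, and every other
  inner product then becomes a real multiple of the corresponding quotient in the theorem. Hence
  real quotients make \<open>T\<close> unitarily equivalent to a symmetric matrix.

  Conversely, let \<open>S = U\<^sup>* T U\<close> be symmetric. Then \<open>S\<^sup>*\<close> is the entrywise conjugate of \<open>S\<close>, so the
  self-adjoint and skew parts of \<open>S\<close> show that \<open>U\<^sup>* A U\<close> and \<open>U\<^sup>* B U\<close> are real matrices
  (\<open>real_parts_of_symmetric\<close>). Their eigenvalues are real as well, so entrywise conjugation maps each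
  eigenspace to itself; if the eigenvalues are distinct, the eigenspaces are lines, and conjugation
  multiplies the vectors \<open>U\<^sup>* g\<^sub>i\<close> and \<open>U\<^sup>* h\<^sub>j\<close> by scalars \<open>c\<^sub>i\<close> and \<open>d\<^sub>j\<close>
  (\<open>conjugation_of_simple_eigenbasis\<close>). The conjugate of \<open>\<langle>g\<^sub>i, h\<^sub>j\<rangle>\<close> is therefore
  \<open>c\<^sub>i d\<^sub>j\<^sup>*\<close> times \<open>\<langle>g\<^sub>i, h\<^sub>j\<rangle>\<close>. In the quotient these factors cancel up to \<open>c\<^sub>1 d\<^sub>1\<^sup>*\<close>, which is \<open>1\<close>
  because \<open>\<langle>g\<^sub>1, h\<^sub>1\<rangle>\<close> is real and nonzero.
\<close>

section \<open>Entrywise conjugation and adjoints\<close>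

interpretation cnj: semiring_hom cnj
  by unfold_locales auto

lemma mat_adjoint_eq_transpose_cnj:
  fixes M :: "complex mat"
  shows "mat_adjoint M = transpose_mat (map_mat cnj M)"
  by (rule eq_matI) (auto simp: mat_adjoint_dim mat_adjoint_index)

lemma mat_adjoint_carrier:
  fixes M :: "complex mat"
  assumes "M \<in> carrier_mat r c"
  shows "mat_adjoint M \<in> carrier_mat c r"
  using assms by (auto simp: mat_adjoint_dim)

lemma mat_adjoint_mult:
  fixes M N :: "complex mat"
  assumes M: "M \<in> carrier_mat r m" and N: "N \<in> carrier_mat m c"
  shows "mat_adjoint (M * N) = mat_adjoint N * mat_adjoint M"
  using assms unfolding mat_adjoint_eq_transpose_cnj cnj.mat_hom_mult[OF M N]
  by (subst transpose_mult[where n = m]) auto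

lemma mat_adjoint_adjoint:
  fixes M :: "complex mat"
  shows "mat_adjoint (mat_adjoint M) = M"
  by (rule eq_matI) (auto simp: mat_adjoint_dim mat_adjoint_index)

lemma cnj_mat_adjoint:
  fixes M :: "complex mat"
  shows "map_mat cnj (mat_adjoint M) = mat_adjoint (map_mat cnj M)"
  by (rule eq_matI) (auto simp: mat_adjoint_dim mat_adjoint_index)

lemma mat_adjoint_mat_diag:
  "mat_adjoint (mat_diag n d) = mat_diag n (\<lambda>i. cnj (d i))"
  by (rule eq_matI) (auto simp: mat_adjoint_dim mat_adjoint_index mat_diag_def)

lemma mat_adjoint_sandwich:
  fixes M N :: "complex mat"
  assumes M: "M \<in> carrier_mat n n" and N: "N \<in> carrier_mat n n"
  shows "mat_adjoint (mat_adjoint M * N * M) = mat_adjoint M * mat_adjoint N * M"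
proof -
  note adj = mat_adjoint_carrier[OF M] mat_adjoint_carrier[OF N]
  have "mat_adjoint (mat_adjoint M * N * M) = mat_adjoint M * mat_adjoint (mat_adjoint M * N)"
    using M N adj by (intro mat_adjoint_mult[where m = n]) auto
  also have "mat_adjoint (mat_adjoint M * N) = mat_adjoint N * M"
    using M N adj by (subst mat_adjoint_mult[where m = n]) (auto simp: mat_adjoint_adjoint)
  finally show ?thesis
    using M adj by (simp add: mult_carrier_mat[of _ n n _ n] assoc_mult_mat[of _ n n _ n _ n])
qed

lemma sandwich_add_smult:
  fixes M A B :: "complex mat"
  assumes "M \<in> carrier_mat n n" "A \<in> carrier_mat n n" "B \<in> carrier_mat n n"
  shows "mat_adjoint M * (A + c \<cdot>\<^sub>m B) * M = mat_adjoint M * A * M + c \<cdot>\<^sub>m (mat_adjoint M * B * M)"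
proof -
  note M' = mat_adjoint_carrier[OF assms(1)]
  have "mat_adjoint M * (A + c \<cdot>\<^sub>m B) = mat_adjoint M * A + c \<cdot>\<^sub>m (mat_adjoint M * B)"
    using assms M' by (simp add: mult_add_distrib_mat[of _ n n _ n] mult_smult_distrib[of _ n n _ n])
  moreover have "(mat_adjoint M * A + c \<cdot>\<^sub>m (mat_adjoint M * B)) * M
      = mat_adjoint M * A * M + c \<cdot>\<^sub>m (mat_adjoint M * B) * M"
    using assms M' by (intro add_mult_distrib_mat[of _ n n _ _ n]) auto
  moreover have "c \<cdot>\<^sub>m (mat_adjoint M * B) * M = c \<cdot>\<^sub>m (mat_adjoint M * B * M)"
    using assms M' by (intro mult_smult_assoc_mat[of _ n n _ n]) auto
  ultimately show ?thesis by simp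
qed

lemma unitary_mat_cancel:
  assumes U: "unitary_mat n U" and X: "X \<in> carrier_mat n m"
  shows "mat_adjoint U * (U * X) = X" and "U * (mat_adjoint U * X) = X"
proof -
  have c: "U \<in> carrier_mat n n" "mat_adjoint U \<in> carrier_mat n n"
    using U mat_adjoint_carrier by (auto simp: unitary_mat_def)
  show "mat_adjoint U * (U * X) = X"
    using U X c unfolding unitary_mat_def
    by (simp flip: assoc_mult_mat[OF c(2) c(1) X])
  show "U * (mat_adjoint U * X) = X"
    using U X c unfolding unitary_mat_def
    by (simp flip: assoc_mult_mat[OF c(1) c(2) X])
qed

lemma unitary_mat_adjoint_mult:
  assumes U: "unitary_mat n U" and G: "unitary_mat n G"
  shows "unitary_mat n (mat_adjoint U * G)"
proof -
  have c: "U \<in> carrier_mat n n" "mat_adjoint U \<in> carrier_mat n n"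
    "G \<in> carrier_mat n n" "mat_adjoint G \<in> carrier_mat n n"
    using U G mat_adjoint_carrier by (auto simp: unitary_mat_def)
  have adj: "mat_adjoint (mat_adjoint U * G) = mat_adjoint G * U"
    using c by (simp add: mat_adjoint_mult[of _ n n _ n] mat_adjoint_adjoint)
  have "mat_adjoint G * U * (mat_adjoint U * G) = 1\<^sub>m n" (is ?eq)
    using c U G by (simp add: mult_carrier_mat[of _ n n _ n] assoc_mult_mat[of _ n n _ n _ n] unitary_mat_cancel[where n = n and m = n] unitary_mat_def)
  moreover have "mat_adjoint U * G * (mat_adjoint G * U) = 1\<^sub>m n"
    using c by (intro mat_mult_left_right_inverse[OF _ _ \<open>?eq\<close>]) auto
  ultimately show ?thesis
    using c by (simp add: unitary_mat_def adj)
qed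

section \<open>Eigenvector matrices\<close>

text \<open>
  The index shift reconciles families indexed by \<open>{1..n}\<close> with matrix indices starting at \<open>0\<close>.
\<close>
definition scaled_columns ::
    "nat \<Rightarrow> (nat \<Rightarrow> complex) \<Rightarrow> (nat \<Rightarrow> complex vec) \<Rightarrow> complex mat" where
  "scaled_columns n s g = mat n n (\<lambda>(k, i). s (Suc i) * g (Suc i) $ k)"

lemma scaled_columns_carrier [simp]: "scaled_columns n s g \<in> carrier_mat n n"
  by (simp add: scaled_columns_def)

lemma adjoint_scaled_columns_mult_index:
  assumes "i < n" "j < n" "g (Suc i) \<in> carrier_vec n" "h (Suc j) \<in> carrier_vec n"
  shows "(mat_adjoint (scaled_columns n t h) * scaled_columns n s g) $$ (j, i)
    = s (Suc i) * cnj (t (Suc j)) * (g (Suc i) \<bullet>c h (Suc j))"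
  using assms
  by (simp add: scaled_columns_def mat_adjoint_dim mat_adjoint_index times_mat_def scalar_prod_def
      sum_distrib_left mult_ac)

lemma unitary_scaled_columns:
  assumes g: "\<And>i. i \<in> {1..n} \<Longrightarrow> g i \<in> carrier_vec n"
    and orth: "\<And>i j. i \<in> {1..n} \<Longrightarrow> j \<in> {1..n} \<Longrightarrow> i \<noteq> j \<Longrightarrow> g i \<bullet>c g j = 0"
    and norm: "\<And>i. i \<in> {1..n} \<Longrightarrow> s i * cnj (s i) * (g i \<bullet>c g i) = 1"
  shows "unitary_mat n (scaled_columns n s g)"
proof -
  let ?G = "scaled_columns n s g"
  have left: "mat_adjoint ?G * ?G = 1\<^sub>m n"
    using g orth norm
    by (intro eq_matI)
      (auto simp: adjoint_scaled_columns_mult_index mat_adjoint_dim scaled_columns_def[THEN arg_cong[of _ _ dim_row]]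
        scaled_columns_def[THEN arg_cong[of _ _ dim_col]] simp del: index_mult_mat(1))
  moreover have "?G * mat_adjoint ?G = 1\<^sub>m n"
    by (rule mat_mult_left_right_inverse[OF _ _ left]) (auto intro: mat_adjoint_carrier)
  ultimately show ?thesis by (simp add: unitary_mat_def)
qed

lemma eigenvectors_scaled_columns:
  assumes A: "A \<in> carrier_mat n n"
    and ev: "\<forall>i\<in>{1..n}. \<exists>k. eigenvector A (g i) k"
  shows "\<exists>d. \<forall>s. A * scaled_columns n s g = scaled_columns n s g * mat_diag n d"
proof -
  from ev obtain k where k: "\<And>i. i \<in> {1..n} \<Longrightarrow> eigenvector A (g i) (k i)" by metis
  have "A * scaled_columns n s g = scaled_columns n s g * mat_diag n (\<lambda>i. k (Suc i))" for s
  proof (rule eq_matI)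
    fix l i assume "l < dim_row (scaled_columns n s g * mat_diag n (\<lambda>i. k (Suc i)))"
      and "i < dim_col (scaled_columns n s g * mat_diag n (\<lambda>i. k (Suc i)))"
    then have li: "l < n" "i < n" by (auto simp: scaled_columns_def mat_diag_def)
    with k[of "Suc i"] A have gi: "g (Suc i) \<in> carrier_vec n"
      and e: "A *\<^sub>v g (Suc i) = k (Suc i) \<cdot>\<^sub>v g (Suc i)"
      by (auto simp: eigenvector_def)
    have "(A * scaled_columns n s g) $$ (l, i) = s (Suc i) * (A *\<^sub>v g (Suc i)) $ l"
      using li A gi by (simp add: scaled_columns_def scalar_prod_def sum_distrib_left mult_ac)
    also have "\<dots> = (scaled_columns n s g * mat_diag n (\<lambda>i. k (Suc i))) $$ (l, i)"
      using li gi by (simp add: e mat_diag_mult_right[of _ n]) (simp add: scaled_columns_def)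
    finally show "(A * scaled_columns n s g) $$ (l, i)
        = (scaled_columns n s g * mat_diag n (\<lambda>i. k (Suc i))) $$ (l, i)" .
  qed (use A in \<open>auto simp: scaled_columns_def mat_diag_def\<close>)
  then show ?thesis by blast
qed

lemma unitary_diagonalization:
  assumes A: "A \<in> carrier_mat n n" and G: "unitary_mat n G" and AG: "A * G = G * mat_diag n d"
  shows "mat_adjoint G * A * G = mat_diag n d" and "A = G * mat_diag n d * mat_adjoint G"
proof -
  have c: "G \<in> carrier_mat n n" "mat_adjoint G \<in> carrier_mat n n"
    using G mat_adjoint_carrier by (auto simp: unitary_mat_def)
  show "mat_adjoint G * A * G = mat_diag n d"
    using A G c by (simp add: mult_carrier_mat[of _ n n _ n] assoc_mult_mat[of _ n n _ n _ n] AG unitary_mat_cancel[where n = n and m = n])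
  have "G * mat_diag n d * mat_adjoint G = A * (G * mat_adjoint G)"
    using A c by (simp add: mult_carrier_mat[of _ n n _ n] assoc_mult_mat[of _ n n _ n _ n] flip: AG)
  then show "A = G * mat_diag n d * mat_adjoint G"
    using A G by (simp add: unitary_mat_def)
qed

text \<open>The spectrum is the set of diagonal entries, so a repeated entry would make it too small.\<close>
lemma diagonalization_inj_on:
  assumes A: "A \<in> carrier_mat n n" and G: "unitary_mat n G" and AG: "A * G = G * mat_diag n d"
    and card: "card (spectrum A) = n"
  shows "inj_on d {0..<n}"
proof -
  have c: "G \<in> carrier_mat n n" "mat_adjoint G \<in> carrier_mat n n"
    using G mat_adjoint_carrier by (auto simp: unitary_mat_def)
  have "similar_mat A (mat_diag n d)"
    using A G c unitary_diagonalization(2)[OF A G AG]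
    by (intro similar_matI[where P = G and Q = "mat_adjoint G" and n = n]) (auto simp: unitary_mat_def)
  then have "char_poly A = char_poly (mat_diag n d)" by (rule char_poly_similar)
  also have "\<dots> = (\<Prod>a\<leftarrow>diag_mat (mat_diag n d). [:- a, 1:])"
    by (rule char_poly_upper_triangular[where n = n]) (auto simp: upper_triangular_def mat_diag_def)
  also have "diag_mat (mat_diag n d) = map d [0..<n]"
    by (auto simp: diag_mat_def mat_diag_def)
  finally have "spectrum A = d ` {0..<n}"
    unfolding spectrum_root_char_poly[OF A]
    by (auto simp: poly_prod_list prod_list_zero_iff)
  with card show ?thesis by (intro eq_card_imp_inj_on) auto
qed

section \<open>Real position of the two eigenbases gives symmetry\<close>

lemma complex_symmetric_add_smult:
  assumes "complex_symmetric n M" "complex_symmetric n N"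
  shows "complex_symmetric n (M + c \<cdot>\<^sub>m N)"
proof -
  have "transpose_mat (c \<cdot>\<^sub>m N) = c \<cdot>\<^sub>m transpose_mat N" by (rule eq_matI) auto
  with assms show ?thesis
    using transpose_add[of M n n "c \<cdot>\<^sub>m N"] by (simp add: complex_symmetric_def)
qed

text \<open>
  In the basis \<open>G\<close>, the matrix \<open>A\<close> is diagonal and \<open>B\<close> is \<open>W\<^sup>* E W\<close> with \<open>W = H\<^sup>* G\<close>; for real \<open>W\<close> the
  adjoint is the transpose and \<open>W\<^sup>t E W\<close> is symmetric.
\<close>
lemma symmetric_in_real_position:
  assumes A: "A \<in> carrier_mat n n" and B: "B \<in> carrier_mat n n"
    and G: "unitary_mat n G" and H: "unitary_mat n H"
    and AG: "A * G = G * mat_diag n d" and BH: "B * H = H * mat_diag n e"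
    and real: "map_mat cnj (mat_adjoint H * G) = mat_adjoint H * G"
  shows "complex_symmetric n (mat_adjoint G * (A + \<i> \<cdot>\<^sub>m B) * G)"
proof -
  define W where "W = mat_adjoint H * G"
  have c: "G \<in> carrier_mat n n" "mat_adjoint G \<in> carrier_mat n n"
    "H \<in> carrier_mat n n" "mat_adjoint H \<in> carrier_mat n n"
    using G H mat_adjoint_carrier by (auto simp: unitary_mat_def)
  then have W: "W \<in> carrier_mat n n" by (simp add: W_def)
  have D: "complex_symmetric n (mat_diag n f)" for f
    by (auto simp: complex_symmetric_def mat_diag_def intro!: eq_matI)
  have Wt: "mat_adjoint W = transpose_mat W"
    using real by (simp add: mat_adjoint_eq_transpose_cnj W_def)
  have "mat_adjoint G * B * G = mat_adjoint G * (H * mat_diag n e * mat_adjoint H) * G"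
    using unitary_diagonalization(2)[OF B H BH] by simp
  also have "\<dots> = mat_adjoint G * H * (mat_diag n e * (mat_adjoint H * G))"
    using c by (simp add: mult_carrier_mat[of _ n n _ n] assoc_mult_mat[of _ n n _ n _ n])
  also have "mat_adjoint G * H = mat_adjoint W"
    using c by (simp add: W_def mat_adjoint_mult[of _ n n _ n] mat_adjoint_adjoint)
  finally have BW: "mat_adjoint G * B * G = transpose_mat W * (mat_diag n e * W)"
    by (simp only: Wt flip: W_def)
  have "transpose_mat (transpose_mat W * (mat_diag n e * W)) = transpose_mat W * mat_diag n e * W"
    using W D[of e] by (simp add: transpose_mult[of _ n n _ n] mult_carrier_mat[of _ n n _ n] complex_symmetric_def)
  then have "complex_symmetric n (mat_adjoint G * B * G)"
    using W unfolding BW by (simp add: complex_symmetric_def mult_carrier_mat[of _ n n _ n] assoc_mult_mat[of _ n n _ n _ n])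
  with D show ?thesis
    using c A B
    by (simp add: sandwich_add_smult unitary_diagonalization(1)[OF A G AG] complex_symmetric_add_smult)
qed

section \<open>Symmetry makes the Cartesian parts real\<close>

text \<open>
  Entrywise, symmetry says \<open>a\<^sub>i\<^sub>j + i b\<^sub>i\<^sub>j = a\<^sub>j\<^sub>i + i b\<^sub>j\<^sub>i\<close> while self-adjointness identifies \<open>a\<^sub>j\<^sub>i\<close> and
  \<open>b\<^sub>j\<^sub>i\<close> with the conjugates of \<open>a\<^sub>i\<^sub>j\<close> and \<open>b\<^sub>i\<^sub>j\<close>. Hence \<open>Im a\<^sub>i\<^sub>j + i Im b\<^sub>i\<^sub>j = 0\<close>, a complex number
  with real components.
\<close>
lemma real_parts_of_symmetric:
  assumes M: "self_adjoint n M" and N: "self_adjoint n N"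
    and sym: "complex_symmetric n (M + \<i> \<cdot>\<^sub>m N)"
  shows "map_mat cnj M = M" and "map_mat cnj N = N"
proof -
  have c: "M \<in> carrier_mat n n" "N \<in> carrier_mat n n"
    using M N by (auto simp: self_adjoint_def)
  have entries: "cnj (M $$ (i, j)) = M $$ (i, j) \<and> cnj (N $$ (i, j)) = N $$ (i, j)"
    if ij: "i < n" "j < n" for i j
  proof -
    have "M $$ (j, i) = cnj (M $$ (i, j))" "N $$ (j, i) = cnj (N $$ (i, j))"
      using M N c ij mat_adjoint_index[of j M i] mat_adjoint_index[of j N i]
      by (auto simp: self_adjoint_def)
    moreover have "transpose_mat (M + \<i> \<cdot>\<^sub>m N) $$ (i, j) = (M + \<i> \<cdot>\<^sub>m N) $$ (i, j)"
      using sym by (simp add: complex_symmetric_def)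
    then have "M $$ (j, i) + \<i> * N $$ (j, i) = M $$ (i, j) + \<i> * N $$ (i, j)"
      using c ij by simp
    ultimately show ?thesis by (simp add: complex_eq_iff)
  qed
  show "map_mat cnj M = M" "map_mat cnj N = N"
    using c entries by (auto intro!: eq_matI)
qed

lemma commutes_with_distinct_diag_imp_diag:
  fixes K :: "complex mat"
  assumes K: "K \<in> carrier_mat n n" and inj: "inj_on d {0..<n}"
    and comm: "mat_diag n d * K = K * mat_diag n d"
  shows "K = mat_diag n (\<lambda>i. K $$ (i, i))"
proof (rule eq_matI)
  fix i j assume "i < dim_row (mat_diag n (\<lambda>i. K $$ (i, i)))" "j < dim_col (mat_diag n (\<lambda>i. K $$ (i, i)))"
  then have ij: "i < n" "j < n" by (auto simp: mat_diag_def)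
  have "(mat_diag n d * K) $$ (i, j) = (K * mat_diag n d) $$ (i, j)" by (simp add: comm)
  then have "d i * K $$ (i, j) = K $$ (i, j) * d j"
    using ij K by (simp add: mat_diag_mult_left[of _ n n] mat_diag_mult_right[of _ n n] del: index_mult_mat(1))
  moreover have "d i \<noteq> d j" if "i \<noteq> j" using that ij inj by (auto dest: inj_onD)
  ultimately show "K $$ (i, j) = mat_diag n (\<lambda>i. K $$ (i, i)) $$ (i, j)"
    using ij by (auto simp: mat_diag_def)
qed (use K in \<open>auto simp: mat_diag_def\<close>)

text \<open>
  Write \<open>P = U\<^sup>* G\<close>, a matrix of eigenvectors of the real matrix \<open>U\<^sup>* A U\<close>. Since \<open>A\<close> is self-adjoint,
  its eigenvalues are real, and conjugating the eigenvalue equation shows that the conjugate of \<open>P\<close>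
  satisfies it too. So the change of basis from \<open>P\<close> to its conjugate commutes with the diagonal
  matrix of eigenvalues. These being distinct, that change of basis is itself diagonal.
\<close>
lemma conjugation_of_simple_eigenbasis:
  assumes A: "self_adjoint n A" and U: "unitary_mat n U" and G: "unitary_mat n G"
    and AG: "A * G = G * mat_diag n d" and inj: "inj_on d {0..<n}"
    and real: "map_mat cnj (mat_adjoint U * A * U) = mat_adjoint U * A * U"
  shows "\<exists>c. map_mat cnj (mat_adjoint U * G) = mat_adjoint U * G * mat_diag n c"
proof -
  define P where "P = mat_adjoint U * G"
  define P' where "P' = map_mat cnj P"
  define M where "M = mat_adjoint U * A * U"
  have c: "U \<in> carrier_mat n n" "mat_adjoint U \<in> carrier_mat n n"
    "G \<in> carrier_mat n n" "mat_adjoint G \<in> carrier_mat n n" "A \<in> carrier_mat n n"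
    using U G A mat_adjoint_carrier by (auto simp: unitary_mat_def self_adjoint_def)
  have P: "unitary_mat n P" unfolding P_def by (rule unitary_mat_adjoint_mult[OF U G])
  have cP: "P \<in> carrier_mat n n" "mat_adjoint P \<in> carrier_mat n n" "P' \<in> carrier_mat n n"
    "M \<in> carrier_mat n n"
    using c P mat_adjoint_carrier[of P n n] by (auto simp: P'_def M_def unitary_mat_def)
  have MP: "M * P = P * mat_diag n d"
    using c U by (simp add: M_def P_def mult_carrier_mat[of _ n n _ n] assoc_mult_mat[of _ n n _ n _ n] unitary_mat_cancel[where n = n and m = n] AG)
  have M: "mat_adjoint M = M"
    using A mat_adjoint_sandwich[OF c(1,5)] by (simp add: M_def self_adjoint_def)
  have d: "mat_diag n (\<lambda>i. cnj (d i)) = mat_diag n d"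
    using mat_adjoint_sandwich[OF cP(1,4)] unitary_diagonalization(1)[OF cP(4) P MP] M
    by (simp flip: mat_adjoint_mat_diag)
  have MP': "M * P' = P' * mat_diag n d"
  proof -
    have "map_mat cnj (M * P) = map_mat cnj (P * mat_diag n d)" by (simp add: MP)
    moreover have "map_mat cnj (mat_diag n d) = mat_diag n (\<lambda>i. cnj (d i))"
      by (rule eq_matI) (auto simp: mat_diag_def)
    ultimately show ?thesis
      using real cP d by (simp add: cnj.mat_hom_mult[of _ n n _ n] P'_def M_def)
  qed
  have PM: "mat_adjoint P * M = mat_diag n d * mat_adjoint P"
    using arg_cong[OF MP, of mat_adjoint] cP
    by (simp add: mat_adjoint_mult[of _ n n _ n] M mat_adjoint_mat_diag d)
  define K where "K = mat_adjoint P * P'"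
  have K: "K \<in> carrier_mat n n" using cP by (simp add: K_def)
  have "mat_diag n d * K = mat_adjoint P * M * P'"
    using cP by (simp add: K_def PM mult_carrier_mat[of _ n n _ n] assoc_mult_mat[of _ n n _ n _ n])
  also have "\<dots> = K * mat_diag n d"
    using cP by (simp add: K_def MP' mult_carrier_mat[of _ n n _ n] assoc_mult_mat[of _ n n _ n _ n])
  finally have "K = mat_diag n (\<lambda>i. K $$ (i, i))"
    by (rule commutes_with_distinct_diag_imp_diag[OF K inj])
  moreover have "P' = P * K"
    using cP by (simp add: K_def unitary_mat_cancel[OF P, where m = n])
  ultimately show ?thesis unfolding P'_def P_def by metis
qed

text \<open>
  The matrix \<open>H\<^sup>* G\<close> of inner products does not see the common rotation by \<open>U\<^sup>*\<close>, so its conjugate is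
  obtained from itself by the diagonal factors of the two eigenbases.
\<close>
lemma conjugate_of_inner_products:
  assumes A: "self_adjoint n A" and B: "self_adjoint n B"
    and U: "unitary_mat n U" and G: "unitary_mat n G" and H: "unitary_mat n H"
    and AG: "A * G = G * mat_diag n d" and injd: "inj_on d {0..<n}"
    and BH: "B * H = H * mat_diag n e" and inje: "inj_on e {0..<n}"
    and sym: "complex_symmetric n (mat_adjoint U * (A + \<i> \<cdot>\<^sub>m B) * U)"
  shows "\<exists>c f. \<forall>i<n. \<forall>j<n. cnj ((mat_adjoint H * G) $$ (j, i)) = c i * f j * (mat_adjoint H * G) $$ (j, i)"
proof -
  have c: "U \<in> carrier_mat n n" "mat_adjoint U \<in> carrier_mat n n"
    "G \<in> carrier_mat n n" "mat_adjoint G \<in> carrier_mat n n"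
    "H \<in> carrier_mat n n" "mat_adjoint H \<in> carrier_mat n n"
    "A \<in> carrier_mat n n" "B \<in> carrier_mat n n"
    using U G H A B mat_adjoint_carrier by (auto simp: unitary_mat_def self_adjoint_def)
  have sa: "self_adjoint n (mat_adjoint U * A * U)" "self_adjoint n (mat_adjoint U * B * U)"
    using A B c(1,2) mat_adjoint_sandwich[OF c(1,7)] mat_adjoint_sandwich[OF c(1,8)]
    by (simp_all add: self_adjoint_def mult_carrier_mat[of _ n n _ n])
  have sum: "complex_symmetric n (mat_adjoint U * A * U + \<i> \<cdot>\<^sub>m (mat_adjoint U * B * U))"
    using sym c by (simp add: sandwich_add_smult)
  note real = real_parts_of_symmetric[OF sa sum]
  define P where "P = mat_adjoint U * G"
  define Q where "Q = mat_adjoint U * H"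
  obtain k where k: "map_mat cnj P = P * mat_diag n k"
    using conjugation_of_simple_eigenbasis[OF A U G AG injd real(1)] unfolding P_def by blast
  obtain l where l: "map_mat cnj Q = Q * mat_diag n l"
    using conjugation_of_simple_eigenbasis[OF B U H BH inje real(2)] unfolding Q_def by blast
  have cP: "P \<in> carrier_mat n n" "Q \<in> carrier_mat n n" "mat_adjoint Q \<in> carrier_mat n n"
    using c by (auto simp: P_def Q_def intro: mat_adjoint_carrier)
  define W where "W = mat_adjoint H * G"
  have cW: "W \<in> carrier_mat n n" using c by (simp add: W_def)
  have W: "W = mat_adjoint Q * P"
    using c U
    by (simp add: W_def P_def Q_def mat_adjoint_mult[of _ n n _ n] mat_adjoint_adjoint
        mult_carrier_mat[of _ n n _ n] assoc_mult_mat[of _ n n _ n _ n] unitary_mat_cancel[where n = n and m = n])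
  have "map_mat cnj W = mat_adjoint (map_mat cnj Q) * map_mat cnj P"
    using cP by (simp add: W cnj.mat_hom_mult[of _ n n _ n] cnj_mat_adjoint)
  also have "\<dots> = mat_diag n (\<lambda>j. cnj (l j)) * (W * mat_diag n k)"
    using cP
    by (simp add: k l W mat_adjoint_mult[of _ n n _ n] mat_adjoint_mat_diag
        mult_carrier_mat[of _ n n _ n] assoc_mult_mat[of _ n n _ n _ n])
  finally have eq: "map_mat cnj W = mat_diag n (\<lambda>j. cnj (l j)) * (W * mat_diag n k)" .
  have "cnj (W $$ (j, i)) = k i * cnj (l j) * W $$ (j, i)" if "i < n" "j < n" for i j
  proof -
    have "cnj (W $$ (j, i)) = (mat_diag n (\<lambda>j. cnj (l j)) * (W * mat_diag n k)) $$ (j, i)"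
      using that cW by (simp flip: eq)
    also have "\<dots> = cnj (l j) * (W $$ (j, i) * k i)"
      using that cW
      by (simp add: mat_diag_mult_left[of _ n n] mat_diag_mult_right[of _ n n]
          del: index_mult_mat(1) assoc_mult_mat)
    finally show ?thesis by simp
  qed
  then have "\<forall>i<n. \<forall>j<n. cnj (W $$ (j, i)) = k i * cnj (l j) * W $$ (j, i)" by blast
  then show ?thesis unfolding W_def
    by (rule exI[of _ k, OF exI[of _ "\<lambda>j. cnj (l j)"]])
qed

section \<open>Normalization and the quotients\<close>

text \<open>Real-valued, so that dividing by the norm does not affect whether an inner product is real.\<close>
definition complex_vec_norm :: "complex vec \<Rightarrow> real" where
  "complex_vec_norm v = sqrt (Re (v \<bullet>c v))"

lemma complex_vec_norm:
  assumes "v \<in> carrier_vec n" "v \<noteq> 0\<^sub>v n"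
  shows "complex_vec_norm v > 0" and "v \<bullet>c v = of_real (complex_vec_norm v) * of_real (complex_vec_norm v)"
proof -
  have "v \<bullet>c v > 0" using conjugate_square_greater_0_vec assms by blast
  then have r: "Re (v \<bullet>c v) > 0" "Im (v \<bullet>c v) = 0" by (auto simp: less_complex_def)
  then show "complex_vec_norm v > 0" by (simp add: complex_vec_norm_def)
  have "complex_vec_norm v * complex_vec_norm v = Re (v \<bullet>c v)"
    using r by (simp add: complex_vec_norm_def)
  with r show "v \<bullet>c v = of_real (complex_vec_norm v) * of_real (complex_vec_norm v)"
    by (simp add: complex_eq_iff)
qed

lemma unitary_normalized_columns:
  assumes g: "\<And>i. i \<in> {1..n} \<Longrightarrow> g i \<in> carrier_vec n" "\<And>i. i \<in> {1..n} \<Longrightarrow> g i \<noteq> 0\<^sub>v n"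
    and orth: "orthogonal_basis n g"
    and phase: "\<And>i. i \<in> {1..n} \<Longrightarrow> cmod (p i) = 1"
  shows "unitary_mat n (scaled_columns n (\<lambda>i. p i / of_real (complex_vec_norm (g i))) g)"
proof (rule unitary_scaled_columns)
  fix i assume i: "i \<in> {1..n}"
  have "p i * cnj (p i) = 1" using phase[OF i] by (simp add: complex_norm_square[symmetric])
  then show "p i / of_real (complex_vec_norm (g i)) * cnj (p i / of_real (complex_vec_norm (g i))) * (g i \<bullet>c g i) = 1"
    using complex_vec_norm[OF g(1)[OF i] g(2)[OF i]] by (simp add: field_simps)
qed (use g orth in \<open>auto simp: orthogonal_basis_def\<close>)

lemma cnj_sgn_mult_self: "cnj (sgn z) * z = of_real (cmod z)"
  by (cases "z = 0") (auto simp: sgn_eq complex_norm_square[symmetric] power2_eq_square field_simps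
      simp flip: of_real_mult)

theorem theorem1:
  fixes n :: nat
    and T A B :: "complex mat"
    and g h :: "nat \<Rightarrow> complex vec"
  assumes "n \<ge> 1"
    and "T \<in> carrier_mat n n"
    and "cartesian_decomposition n T A B"
    and "proper_pair n g h"
    and "\<forall>i\<in>{1..n}. \<exists>k. eigenvector A (g i) k"
    and "\<forall>i\<in>{1..n}. \<exists>k. eigenvector B (h i) k"
  shows "((\<forall>i\<in>{2..n}. \<forall>j\<in>{2..n}. (g i \<bullet>c h j) / ((g i \<bullet>c h 1) * (g 1 \<bullet>c h j)) \<in> \<real>) \<longrightarrow>
           (\<exists>S. complex_symmetric n S \<and> unitarily_equivalent n T S)) \<and>
         (card (spectrum A) = n \<and> card (spectrum B) = n \<longrightarrow>
           (\<exists>S. complex_symmetric n S \<and> unitarily_equivalent n T S) \<longrightarrow>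
           (\<forall>i\<in>{2..n}. \<forall>j\<in>{2..n}. (g i \<bullet>c h j) / ((g i \<bullet>c h 1) * (g 1 \<bullet>c h j)) \<in> \<real>))"
proof -
  define w where "w i j = g i \<bullet>c h j" for i j
  have AB: "self_adjoint n A" "self_adjoint n B" "T = A + \<i> \<cdot>\<^sub>m B"
    using assms(3) by (auto simp: cartesian_decomposition_def)
  then have c: "A \<in> carrier_mat n n" "B \<in> carrier_mat n n" by (auto simp: self_adjoint_def)
  have g: "g i \<in> carrier_vec n" "g i \<noteq> 0\<^sub>v n" if "i \<in> {1..n}" for i
    using assms(5) that c by (auto simp: eigenvector_def)
  have h: "h i \<in> carrier_vec n" "h i \<noteq> 0\<^sub>v n" if "i \<in> {1..n}" for i
    using assms(6) that c by (auto simp: eigenvector_def)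
  have orth: "orthogonal_basis n g" "orthogonal_basis n h" and w11: "cnj (w 1 1) = w 1 1"
    using assms(4) by (auto simp: proper_pair_def w_def Reals_cnj_iff)
  have one: "1 \<in> {1..n}" using assms(1) by simp
  with assms(4) have w0: "w i 1 \<noteq> 0" "w 1 i \<noteq> 0" if "i \<in> {1..n}" for i
    using that unfolding proper_pair_def w_def by blast+
  obtain d where d: "\<And>s. A * scaled_columns n s g = scaled_columns n s g * mat_diag n d"
    using eigenvectors_scaled_columns[OF c(1) assms(5)] by blast
  obtain e where e: "\<And>s. B * scaled_columns n s h = scaled_columns n s h * mat_diag n e"
    using eigenvectors_scaled_columns[OF c(2) assms(6)] by blast
  have index: "(mat_adjoint (scaled_columns n t h) * scaled_columns n s g) $$ (j, i)
      = s (Suc i) * cnj (t (Suc j)) * w (Suc i) (Suc j)" if "i < n" "j < n" for i j s t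
    using that g h by (simp add: adjoint_scaled_columns_mult_index w_def del: index_mult_mat(1))
  have sufficient: "\<exists>S. complex_symmetric n S \<and> unitarily_equivalent n T S"
    if real: "\<forall>i\<in>{2..n}. \<forall>j\<in>{2..n}. w i j / (w i 1 * w 1 j) \<in> \<real>"
  proof -
    have quot: "w i j / (w i 1 * w 1 j) \<in> \<real>" if ij: "i \<in> {1..n}" "j \<in> {1..n}" for i j
    proof (cases "i = 1 \<or> j = 1")
      case True
      \<comment> \<open>In the first row and column the quotient is the inverse of the real number \<open>\<langle>g\<^sub>1, h\<^sub>1\<rangle>\<close>.\<close>
      then have "w i j / (w i 1 * w 1 j) = 1 / w 1 1" using w0 ij by auto
      then show ?thesis using w11 by (simp add: Reals_cnj_iff)
    next
      case False
      with real ij show ?thesis by auto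
    qed
    \<comment> \<open>These phases make every inner product of the first row and column real. The one at \<open>\<langle>g\<^sub>1, h\<^sub>1\<rangle>\<close>
      is a sign, so using it for both \<open>g\<^sub>1\<close> and \<open>h\<^sub>1\<close> does no harm.\<close>
    define s where "s i = cnj (sgn (w i 1)) / of_real (complex_vec_norm (g i))" for i
    define t where "t j = sgn (w 1 j) / of_real (complex_vec_norm (h j))" for j
    define G where "G = scaled_columns n s g"
    define H where "H = scaled_columns n t h"
    have G: "unitary_mat n G"
      unfolding G_def s_def using g orth w0
      by (intro unitary_normalized_columns) (auto simp: norm_sgn)
    have H: "unitary_mat n H"
      unfolding H_def t_def using h orth w0
      by (intro unitary_normalized_columns) (auto simp: norm_sgn)
    have entry: "s i * cnj (t j) * w i j \<in> \<real>" if ij: "i \<in> {1..n}" "j \<in> {1..n}" for i j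
    proof -
      have "s i * cnj (t j) * w i j
        = (w i j / (w i 1 * w 1 j)) * (cnj (sgn (w i 1)) * w i 1) * (cnj (sgn (w 1 j)) * w 1 j)
          / (of_real (complex_vec_norm (g i)) * of_real (complex_vec_norm (h j)))"
        using w0 ij by (simp add: s_def t_def)
      moreover obtain q where "w i j / (w i 1 * w 1 j) = of_real q"
        using quot[OF ij] by (auto elim: Reals_cases)
      ultimately show ?thesis
        by (simp only: cnj_sgn_mult_self Reals_of_real flip: of_real_mult of_real_divide)
    qed
    have "map_mat cnj (mat_adjoint H * G) = mat_adjoint H * G"
      unfolding G_def H_def
    proof (rule eq_matI)
      fix j i assume "j < dim_row (mat_adjoint (scaled_columns n t h) * scaled_columns n s g)"
        "i < dim_col (mat_adjoint (scaled_columns n t h) * scaled_columns n s g)"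
      then have ij: "i < n" "j < n" by (auto simp: scaled_columns_def mat_adjoint_dim)
      have "map_mat cnj (mat_adjoint (scaled_columns n t h) * scaled_columns n s g) $$ (j, i)
          = cnj ((mat_adjoint (scaled_columns n t h) * scaled_columns n s g) $$ (j, i))"
        using ij by (intro index_map_mat(1)) (auto simp: scaled_columns_def mat_adjoint_dim)
      also have "\<dots> = (mat_adjoint (scaled_columns n t h) * scaled_columns n s g) $$ (j, i)"
        using entry[of "Suc i" "Suc j"] ij unfolding index[OF ij] Reals_cnj_iff by simp
      finally show "map_mat cnj (mat_adjoint (scaled_columns n t h) * scaled_columns n s g) $$ (j, i)
          = (mat_adjoint (scaled_columns n t h) * scaled_columns n s g) $$ (j, i)" .
    qed auto
    then have "complex_symmetric n (mat_adjoint G * T * G)"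
      unfolding AB(3) using c G H d e
      by (intro symmetric_in_real_position) (auto simp: G_def H_def)
    then show ?thesis
      using G assms(2) by (auto simp: unitarily_equivalent_def complex_symmetric_def)
  qed
  have necessary: "w i j / (w i 1 * w 1 j) \<in> \<real>"
    if card: "card (spectrum A) = n" "card (spectrum B) = n"
      and ue: "\<exists>S. complex_symmetric n S \<and> unitarily_equivalent n T S"
      and ij: "i \<in> {1..n}" "j \<in> {1..n}" for i j
  proof -
    obtain U where U: "unitary_mat n U" "complex_symmetric n (mat_adjoint U * (A + \<i> \<cdot>\<^sub>m B) * U)"
      using ue AB(3) by (auto simp: unitarily_equivalent_def)
    define s where "s i = 1 / complex_of_real (complex_vec_norm (g i))" for i
    define t where "t j = 1 / complex_of_real (complex_vec_norm (h j))" for j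
    define G where "G = scaled_columns n s g"
    define H where "H = scaled_columns n t h"
    have G: "unitary_mat n G" unfolding G_def s_def
      using g orth by (intro unitary_normalized_columns) auto
    have H: "unitary_mat n H" unfolding H_def t_def
      using h orth by (intro unitary_normalized_columns) auto
    have AG: "A * G = G * mat_diag n d" and BH: "B * H = H * mat_diag n e"
      by (simp_all add: G_def H_def d e)
    obtain k f where kf: "\<And>i j. i < n \<Longrightarrow> j < n \<Longrightarrow>
        cnj ((mat_adjoint H * G) $$ (j, i)) = k i * f j * (mat_adjoint H * G) $$ (j, i)"
      using conjugate_of_inner_products[OF AB(1,2) U(1) G H
          AG diagonalization_inj_on[OF c(1) G AG card(1)]
          BH diagonalization_inj_on[OF c(2) H BH card(2)] U(2)] by blast
    define k' f' where "k' i = k (i - 1)" and "f' j = f (j - 1)" for i j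
    have w: "cnj (w i j) = k' i * f' j * w i j" if ij: "i \<in> {1..n}" "j \<in> {1..n}" for i j
    proof -
      have st: "cnj (s i) = s i" "cnj (t j) = t j" "s i \<noteq> 0" "t j \<noteq> 0"
        using complex_vec_norm(1)[OF g(1)[OF ij(1)] g(2)[OF ij(1)]] complex_vec_norm(1)[OF h(1)[OF ij(2)] h(2)[OF ij(2)]]
        by (auto simp: s_def t_def)
      have "i - 1 < n" "j - 1 < n" using ij by auto
      from kf[OF this] index[OF this, of t s]
      have "cnj (s i * cnj (t j) * w i j) = k' i * f' j * (s i * cnj (t j) * w i j)"
        using ij by (simp add: G_def H_def k'_def f'_def del: index_mult_mat(1))
      with st show ?thesis by simp
    qed
    have k1: "k' 1 * f' 1 = 1" using w[OF one one] w11 w0(1)[OF one] by simp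
    have "k' i \<noteq> 0" using w[OF ij(1) one] w0(1)[OF ij(1)] by auto
    moreover have "f' j \<noteq> 0" using w[OF one ij(2)] w0(2)[OF ij(2)] by auto
    moreover have "cnj (w i j / (w i 1 * w 1 j))
        = (k' i * f' j * w i j) / ((k' 1 * f' 1) * (k' i * f' j * (w i 1 * w 1 j)))"
      using w[OF ij] w[OF ij(1) one] w[OF one ij(2)] by (simp add: mult_ac)
    ultimately show ?thesis using k1 by (simp add: Reals_cnj_iff)
  qed
  show ?thesis
    using sufficient necessary unfolding w_def by auto
qed

end
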